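(* Let $G$ be a virtually $\mathbb{Z}$ group, let $A$ be a finite alphabet, let $\mu$ be a $G$-ergodic probability measure on $A^G$, and let $\varphi\colon A^G\to A^G$ be a cellular automaton. Then $\varphi$ is either $\mu$-sensitive or $\mu$-equicontinuous. In particular, every virtually $\mathbb{Z}$ group satisfies Gilman's dichotomy.
   Context: A group is virtually $\mathbb{Z}$ if it contains a finite index subgroup isomorphic to $\mathbb{Z}$. Let $G$ be a countable group and $A$ a finite set with $|A|\geq 2$. The space $A^G$ carries the product topology (with $A$ discrete) and its Borel $\sigma$-algebra. The shift action of $G$ on $A^G$ is $(gx)_h = x_{g^{-1}h}$. A cellular automaton (CA) is a continuous map $\varphi\colon A^G\to A^G$ with $\varphi(gx)=g\varphi(x)$ for all $g\in G$, $x\in A^G$. A probability measure $\mu$ on $A^G$ is $G$-invariant if $\mu(g^{-1}E)=\mu(E)$ for every measurable $E\subseteq A^G$ and $g\in G$. It is $G$-ergodic if it is $G$-invariant and every measurable set $E\subseteq A^G$ with $g^{-1}E=E$ for all $g\in G$ satisfies $\mu(E)\in\{0,1\}$. A Bernoulli measure on $A^G$ is a product measure $\prod_{g\in G} p$, where $p$ is a probability distribution on $A$ (the same for every coordinate). For a CA $\varphi$, a configuration $x\in A^G$ and a finite set $F\subseteq G$, let $$C(x,F,\varphi)=\{y\in A^G : \varphi^n(y)_F=\varphi^n(x)_F \text{ for all } n\geq 0\},$$ where $z_F$ denotes the restriction of $z$ to $F$. For a probability measure $\mu$ on $A^G$, the CA $\varphi$ is $\mu$-sensitive if there exists a finite set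 $F\subseteq G$ such that $\mu(C(x,F,\varphi))=0$ for $\mu$-almost every $x\in A^G$; it is $\mu$-equicontinuous if for $\mu$-almost every $x\in A^G$ we have $\mu(C(x,F,\varphi))>0$ for every finite $F\subseteq G$. A group $G$ satisfies Gilman's dichotomy if for every finite set $A$ and every Bernoulli measure $\mu$ on $A^G$, every CA $\varphi\colon A^G\to A^G$ is either $\mu$-sensitive or $\mu$-equicontinuous. *)

theory Defs
  imports "HOL-Probability.Probability" "HOL-Algebra.Elementary_Groups"
begin

definition virtually_Z :: "('g, 'm) monoid_scheme \<Rightarrow> bool" where
  "virtually_Z G \<longleftrightarrow>
     (\<exists>H. subgroup H G \<and> finite (rcosets\<^bsub>G\<^esub> H) \<and> G\<lparr>carrier := H\<rparr> \<cong> integer_group)"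

(* A configuration is an extensional function on the carrier of G, so that
   the points of this topology are exactly the maps from carrier G to A. *)
definition config_top :: "('g, 'm) monoid_scheme \<Rightarrow> 'a set \<Rightarrow> ('g \<Rightarrow> 'a) topology" where
  "config_top G A = product_topology (\<lambda>_. discrete_topology A) (carrier G)"

definition config_borel :: "('g, 'm) monoid_scheme \<Rightarrow> 'a set \<Rightarrow> ('g \<Rightarrow> 'a) measure" where
  "config_borel G A = sigma (topspace (config_top G A)) {U. openin (config_top G A) U}"

definition shift :: "('g, 'm) monoid_scheme \<Rightarrow> 'g \<Rightarrow> ('g \<Rightarrow> 'a) \<Rightarrow> 'g \<Rightarrow> 'a" where
  "shift G g x = (\<lambda>h\<in>carrier G. x (inv\<^bsub>G\<^esub> g \<otimes>\<^bsub>G\<^esub> h))"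

definition cellular_automaton ::
    "('g, 'm) monoid_scheme \<Rightarrow> 'a set \<Rightarrow> (('g \<Rightarrow> 'a) \<Rightarrow> 'g \<Rightarrow> 'a) \<Rightarrow> bool" where
  "cellular_automaton G A \<phi> \<longleftrightarrow>
     continuous_map (config_top G A) (config_top G A) \<phi> \<and>
     (\<forall>g\<in>carrier G. \<forall>x\<in>topspace (config_top G A). \<phi> (shift G g x) = shift G g (\<phi> x))"

definition config_prob ::
    "('g, 'm) monoid_scheme \<Rightarrow> 'a set \<Rightarrow> ('g \<Rightarrow> 'a) measure \<Rightarrow> bool" where
  "config_prob G A \<mu> \<longleftrightarrow> prob_space \<mu> \<and> sets \<mu> = sets (config_borel G A)"

definition shift_invariant ::
    "('g, 'm) monoid_scheme \<Rightarrow> 'a set \<Rightarrow> ('g \<Rightarrow> 'a) measure \<Rightarrow> bool" where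
  "shift_invariant G A \<mu> \<longleftrightarrow> config_prob G A \<mu> \<and>
     (\<forall>g\<in>carrier G. \<forall>E\<in>sets \<mu>. emeasure \<mu> (shift G (inv\<^bsub>G\<^esub> g) ` E) = emeasure \<mu> E)"

definition shift_ergodic ::
    "('g, 'm) monoid_scheme \<Rightarrow> 'a set \<Rightarrow> ('g \<Rightarrow> 'a) measure \<Rightarrow> bool" where
  "shift_ergodic G A \<mu> \<longleftrightarrow> shift_invariant G A \<mu> \<and>
     (\<forall>E\<in>sets \<mu>. (\<forall>g\<in>carrier G. shift G (inv\<^bsub>G\<^esub> g) ` E = E) \<longrightarrow> emeasure \<mu> E \<in> {0, 1})"

(* The product sigma-algebra is the Borel one when G is countable and A is finite;
   see sets_PiM_eq_config_borel below. *)
definition bernoulli_measure ::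
    "('g, 'm) monoid_scheme \<Rightarrow> 'a set \<Rightarrow> ('g \<Rightarrow> 'a) measure \<Rightarrow> bool" where
  "bernoulli_measure G A \<mu> \<longleftrightarrow>
     (\<exists>p. prob_space p \<and> sets p = Pow A \<and> \<mu> = PiM (carrier G) (\<lambda>_. p))"

definition orbit_cylinder ::
    "('g, 'm) monoid_scheme \<Rightarrow> 'a set \<Rightarrow> ('g \<Rightarrow> 'a) \<Rightarrow> 'g set
      \<Rightarrow> (('g \<Rightarrow> 'a) \<Rightarrow> 'g \<Rightarrow> 'a) \<Rightarrow> ('g \<Rightarrow> 'a) set" where
  "orbit_cylinder G A x F \<phi> =
     {y \<in> topspace (config_top G A).
        \<forall>n. restrict ((\<phi> ^^ n) y) F = restrict ((\<phi> ^^ n) x) F}"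

definition mu_sensitive ::
    "('g, 'm) monoid_scheme \<Rightarrow> 'a set \<Rightarrow> ('g \<Rightarrow> 'a) measure
      \<Rightarrow> (('g \<Rightarrow> 'a) \<Rightarrow> 'g \<Rightarrow> 'a) \<Rightarrow> bool" where
  "mu_sensitive G A \<mu> \<phi> \<longleftrightarrow>
     (\<exists>F. finite F \<and> F \<subseteq> carrier G \<and>
        (AE x in \<mu>. emeasure \<mu> (orbit_cylinder G A x F \<phi>) = 0))"

definition mu_equicontinuous ::
    "('g, 'm) monoid_scheme \<Rightarrow> 'a set \<Rightarrow> ('g \<Rightarrow> 'a) measure
      \<Rightarrow> (('g \<Rightarrow> 'a) \<Rightarrow> 'g \<Rightarrow> 'a) \<Rightarrow> bool" where
  "mu_equicontinuous G A \<mu> \<phi> \<longleftrightarrow>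
     (AE x in \<mu>. \<forall>F. finite F \<and> F \<subseteq> carrier G \<longrightarrow>
        emeasure \<mu> (orbit_cylinder G A x F \<phi>) > 0)"

(* The alphabets are the finite sets of elements of type 'a. A statement about all finite
   alphabets leaves 'a free, so that it ranges over every type. *)
definition gilman_dichotomy :: "'a itself \<Rightarrow> ('g, 'm) monoid_scheme \<Rightarrow> bool" where
  "gilman_dichotomy (_ :: 'a itself) G \<longleftrightarrow>
     (\<forall>(A :: 'a set) \<mu> \<phi>.
        finite A \<longrightarrow> bernoulli_measure G A \<mu> \<longrightarrow> cellular_automaton G A \<phi> \<longrightarrow>
          mu_sensitive G A \<mu> \<phi> \<or> mu_equicontinuous G A \<mu> \<phi>)"

lemma not_mu_sensitive_and_equicontinuous:
  assumes "prob_space \<mu>" "mu_sensitive G A \<mu> \<phi>" "mu_equicontinuous G A \<mu> \<phi>"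
  shows False
proof -
  obtain F where F: "finite F" "F \<subseteq> carrier G"
    and s: "AE x in \<mu>. emeasure \<mu> (orbit_cylinder G A x F \<phi>) = 0"
    using assms(2) by (auto simp: mu_sensitive_def)
  have "AE x in \<mu>. emeasure \<mu> (orbit_cylinder G A x F \<phi>) > 0"
    using assms(3) F unfolding mu_equicontinuous_def by (auto elim: eventually_mono)
  with s have "AE x in \<mu>. False"
    by eventually_elim simp
  then show False
    using prob_space.AE_False[OF assms(1)] by simp
qed

lemma sets_PiM_eq_config_borel:
  fixes G :: "('g, 'm) monoid_scheme" and A :: "'a set"
  assumes G: "countable (carrier G)" and A: "finite A" and p: "sets p = Pow A"
  shows "sets (PiM (carrier G) (\<lambda>_. p)) = sets (config_borel G A)"
proof -
  let ?I = "carrier G"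
  let ?P = "PiM ?I (\<lambda>_. p)"
  let ?T = "config_top G A"
  have sp: "space p = A"
    using sets_eq_imp_space_eq[of p "count_space A"] p by simp
  have top: "topspace ?T = (\<Pi>\<^sub>E i\<in>?I. A)"
    by (simp add: config_top_def)
  have sub: "{U. openin ?T U} \<subseteq> Pow (topspace ?T)"
    by (auto dest: openin_subset)
  have spB: "space (config_borel G A) = (\<Pi>\<^sub>E i\<in>?I. A)"
    using sub by (simp add: config_borel_def top space_measure_of)
  have stB: "sets (config_borel G A) = sigma_sets (\<Pi>\<^sub>E i\<in>?I. A) {U. openin ?T U}"
    using sub by (simp add: config_borel_def top)
  define cyl where "cyl J y = prod_emb ?I (\<lambda>_. p) J (\<Pi>\<^sub>E i\<in>J. {y i})" for J and y :: "'g \<Rightarrow> 'a"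
  define K where "K = (\<Union>J\<in>{J. finite J \<and> J \<subseteq> ?I}. cyl J ` (\<Pi>\<^sub>E i\<in>J. A))"
  have mem_cyl: "x \<in> cyl J y \<longleftrightarrow> x \<in> (\<Pi>\<^sub>E i\<in>?I. A) \<and> (\<forall>i\<in>J. x i = y i)"
    if "J \<subseteq> ?I" for J x y
    using that by (auto simp: cyl_def prod_emb_def sp PiE_iff restrict_def extensional_def)
  have cylP: "cyl J y \<in> sets ?P" if "finite J" "J \<subseteq> ?I" "\<And>i. i \<in> J \<Longrightarrow> y i \<in> A" for J y
    unfolding cyl_def using that p by (intro sets_PiM_I) auto
  have K: "K \<subseteq> sets ?P"
    by (auto simp: K_def intro!: cylP)
  have cK: "countable K"
    unfolding K_def
  proof (rule countable_UN)
    show "countable {J. finite J \<and> J \<subseteq> ?I}"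
      using countable_Collect_finite_subset[OF G] by (simp add: conj_commute)
    show "countable (cyl J ` (\<Pi>\<^sub>E i\<in>J. A))" if "J \<in> {J. finite J \<and> J \<subseteq> ?I}" for J
      using that A by (intro countable_image countable_finite finite_PiE) auto
  qed
  have base: "\<exists>C\<in>K. x \<in> C \<and> C \<subseteq> U" if U: "openin ?T U" and x: "x \<in> U" for U x
  proof -
    have xs: "x \<in> (\<Pi>\<^sub>E i\<in>?I. A)"
      using openin_subset[OF U] x top by auto
    obtain X where X: "x \<in> (\<Pi>\<^sub>E i\<in>?I. X i)" "finite {i. X i \<noteq> A}" "(\<Pi>\<^sub>E i\<in>?I. X i) \<subseteq> U"
      using product_topology_open_contains_basis[OF U[unfolded config_top_def] x] by auto
    define J where "J = {i. X i \<noteq> A} \<inter> ?I"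
    have J: "finite J" "J \<subseteq> ?I" using X(2) by (auto simp: J_def)
    have "z \<in> (\<Pi>\<^sub>E i\<in>?I. X i)" if "z \<in> cyl J (restrict x J)" for z
    proof (rule PiE_I)
      have z: "z \<in> (\<Pi>\<^sub>E i\<in>?I. A)" "\<forall>i\<in>J. z i = x i"
        using that J by (auto simp: mem_cyl)
      show "z i \<in> X i" if "i \<in> ?I" for i
      proof (cases "X i = A")
        case True
        then show ?thesis using PiE_mem[OF z(1) that] by simp
      next
        case False
        then show ?thesis using PiE_mem[OF X(1) that] z(2) that by (simp add: J_def)
      qed
      show "z i = undefined" if "i \<notin> ?I" for i
        using PiE_arb[OF z(1) that] .
    qed
    then have "cyl J (restrict x J) \<subseteq> U" using X(3) by blast
    moreover have "x \<in> cyl J (restrict x J)" using xs J by (simp add: mem_cyl)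
    moreover have "restrict x J \<in> (\<Pi>\<^sub>E i\<in>J. A)" using xs J(2) by (auto simp: PiE_iff)
    then have "cyl J (restrict x J) \<in> K" using J by (auto simp: K_def)
    ultimately show ?thesis by blast
  qed
  have openP: "U \<in> sets ?P" if U: "openin ?T U" for U
  proof -
    have "countable {C \<in> K. C \<subseteq> U}" using cK by (rule countable_subset[rotated]) simp
    then have "\<Union>{C \<in> K. C \<subseteq> U} \<in> sets ?P" using K by (intro sets.countable_Union) auto
    moreover have "\<Union>{C \<in> K. C \<subseteq> U} = U" using base[OF U] by blast
    ultimately show ?thesis by simp
  qed
  have coordB: "{f \<in> (\<Pi>\<^sub>E i\<in>?I. space p). f i \<in> V} \<in> sets (config_borel G A)"
    if "i \<in> ?I" "V \<in> sets p" for i V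
  proof -
    have "openin ?T {f \<in> topspace ?T. f i \<in> V}"
      unfolding config_top_def
      using that p
      by (intro openin_continuous_map_preimage[where Y="discrete_topology A"]
          continuous_map_product_projection) auto
    then show ?thesis
      by (simp add: stB sp top sigma_sets.Basic)
  qed
  show ?thesis
  proof
    have "sigma_sets (space ?P) {U. openin ?T U} \<subseteq> sets ?P"
      by (rule sets.sigma_sets_subset) (use openP in auto)
    then show "sets (config_borel G A) \<subseteq> sets ?P"
      by (simp add: stB space_PiM sp)
    have "sigma_sets (space (config_borel G A))
            {{f \<in> (\<Pi>\<^sub>E i\<in>?I. space p). f i \<in> V} |i V. i \<in> ?I \<and> V \<in> sets p}
          \<subseteq> sets (config_borel G A)"
      by (rule sets.sigma_sets_subset) (use coordB in auto)
    then show "sets ?P \<subseteq> sets (config_borel G A)"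
      by (simp add: sets_PiM_single spB sp)
  qed
qed

end

theory Submission
  imports Defs
begin

text \<open>A virtually \<open>\<int>\<close> group carries a height function with finite fibres that increases by one under
  left multiplication by some \<open>t\<close> and changes by a bounded amount under right multiplication by a fixed
  element. A slab of heights \<open>[n, n + R]\<close>, with \<open>R\<close> the reach of the local rule, is therefore a wall
  separating the group into two sides.

  If the automaton is not sensitive, ergodicity shows that almost every configuration has an orbit
  cylinder of positive measure over some slab. The configurations with such a slab at height \<open>\<ge> N\<close>
  form sets of the same measure for all \<open>N\<close> (apply \<open>t\<close>), and they increase to that full set as
  \<open>N \<rightarrow> -\<infinity>\<close>. So almost every configuration has such slabs arbitrarily high and, likewise, arbitrarily
  low. Between two of them the evolution is determined by the traces on the walls and the initial
  word; this is a partition with countably many non-null cells, so almost every configuration lies in a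
  cell of positive measure, which gives equicontinuity.

  A Bernoulli measure is mixing along the powers of \<open>t\<close>, hence ergodic.\<close>

section \<open>Height functions on virtually \<open>\<int>\<close> groups\<close>

text \<open>Every \<open>h\<close> is \<open>t [^] ht h\<close> times an element of height zero, so
  the powers of \<open>t\<close> have finitely many right cosets. The height cannot be asked to be a
  homomorphism: the infinite dihedral group has only the trivial one to the integers.\<close>

locale Z_height = group G for G (structure) +
  fixes ht :: "'a \<Rightarrow> int" and t :: 'a
  assumes t_closed [simp]: "t \<in> carrier G"
    and ht_t_mult: "h \<in> carrier G \<Longrightarrow> ht (t \<otimes> h) = ht h + 1"
    and finite_ht_0: "finite {h \<in> carrier G. ht h = 0}"
begin

lemma ht_t_pow_mult:
  assumes "h \<in> carrier G"
  shows "ht (t [^] (n::int) \<otimes> h) = ht h + n"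
proof (induction n rule: int_induct[where k=0])
  case base
  then show ?case using assms by simp
next
  case (step1 i)
  have "t [^] (i + 1) \<otimes> h = t \<otimes> (t [^] i \<otimes> h)"
    using assms int_pow_mult[of t 1 i] by (simp add: m_assoc add.commute)
  then show ?case using step1 assms by (simp add: ht_t_mult)
next
  case (step2 i)
  have "t \<otimes> (t [^] (i - 1) \<otimes> h) = t [^] i \<otimes> h"
    using assms int_pow_mult[of t 1 "i - 1"] by (simp flip: m_assoc)
  then show ?case using step2 assms ht_t_mult[of "t [^] (i - 1) \<otimes> h"] by simp
qed

lemma t_pow_cancel:
  assumes "h \<in> carrier G"
  shows "t [^] (n::int) \<otimes> (t [^] (- n) \<otimes> h) = h"
  using assms int_pow_mult[of t n "- n"] by (simp flip: m_assoc)

definition slab :: "int \<Rightarrow> int \<Rightarrow> 'a set" where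
  "slab a b = {h \<in> carrier G. a \<le> ht h \<and> ht h \<le> b}"

lemma slab_subset: "slab a b \<subseteq> carrier G"
  by (auto simp: slab_def)

lemma translate_slab: "(\<otimes>) (t [^] (k::int)) ` slab a b = slab (a + k) (b + k)"
proof
  show "(\<otimes>) (t [^] k) ` slab a b \<subseteq> slab (a + k) (b + k)"
    by (auto simp: slab_def ht_t_pow_mult)
  show "slab (a + k) (b + k) \<subseteq> (\<otimes>) (t [^] k) ` slab a b"
  proof
    fix h assume h: "h \<in> slab (a + k) (b + k)"
    then have "h = t [^] k \<otimes> (t [^] (- k) \<otimes> h)"
      by (simp add: slab_def t_pow_cancel)
    moreover have "t [^] (- k) \<otimes> h \<in> slab a b"
      using h ht_t_pow_mult[of h "- k"] by (auto simp: slab_def)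
    ultimately show "h \<in> (\<otimes>) (t [^] k) ` slab a b" by blast
  qed
qed

lemma finite_slab [simp]: "finite (slab a b)"
proof -
  have "slab a b = (\<Union>n\<in>{a..b}. (\<otimes>) (t [^] n) ` slab 0 0)"
    unfolding translate_slab by (auto simp: slab_def)
  moreover have "finite (slab 0 0)"
    by (rule finite_subset[OF _ finite_ht_0]) (auto simp: slab_def)
  ultimately show ?thesis by simp
qed

lemma finite_subset_slab:
  assumes "finite F" "F \<subseteq> carrier G"
  obtains N where "F \<subseteq> slab (- N) N"
proof
  \<comment> \<open>The sum of the absolute heights stands in for their maximum, so the empty set is
    no special case.\<close>
  show "F \<subseteq> slab (- (\<Sum>h\<in>F. \<bar>ht h\<bar>)) (\<Sum>h\<in>F. \<bar>ht h\<bar>)"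
  proof
    fix h assume h: "h \<in> F"
    have "\<bar>ht h\<bar> \<le> (\<Sum>h\<in>F. \<bar>ht h\<bar>)"
      using assms h by (intro member_le_sum) auto
    then show "h \<in> slab (- (\<Sum>h\<in>F. \<bar>ht h\<bar>)) (\<Sum>h\<in>F. \<bar>ht h\<bar>)"
      using h assms by (auto simp: slab_def)
  qed
qed

text \<open>Used to identify the product and Borel sigma-algebras for Bernoulli measures, and to
  make the union over all translates in \<open>full_slabs\<close> a countable one.\<close>

lemma countable_carrier: "countable (carrier G)"
proof -
  have "carrier G = (\<Union>n. slab n n)" by (auto simp: slab_def)
  then show ?thesis by (metis countable_UN countable_finite countableI_type finite_slab)
qed

text \<open>Every element is a power of \<^term>\<open>t\<close> times one of the finitely many elements of height zero,
  and left multiplication by a power of \<^term>\<open>t\<close> preserves height differences.\<close>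

lemma ht_mult_bound:
  assumes "finite S" "S \<subseteq> carrier G"
  obtains R where "R \<ge> 0" "\<And>h s. h \<in> carrier G \<Longrightarrow> s \<in> S \<Longrightarrow> \<bar>ht (h \<otimes> s) - ht h\<bar> \<le> R"
proof
  define P where "P = (\<lambda>(h, s). h \<otimes> s) ` (slab 0 0 \<times> S)"
  have P: "finite P" using assms by (simp add: P_def)
  show "(\<Sum>h\<in>P. \<bar>ht h\<bar>) \<ge> 0" by (simp add: sum_nonneg)
  fix h s assume h: "h \<in> carrier G" and s: "s \<in> S"
  define h0 where "h0 = t [^] (- ht h) \<otimes> h"
  have h0: "h0 \<in> carrier G" "ht h0 = 0"
    using h ht_t_pow_mult[of h "- ht h"] by (auto simp: h0_def)
  have "h \<otimes> s = t [^] ht h \<otimes> (h0 \<otimes> s)"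
    using h s assms h0 by (subst m_assoc[symmetric]) (auto simp: h0_def t_pow_cancel)
  then have "ht (h \<otimes> s) - ht h = ht (h0 \<otimes> s)"
    using h0 s assms by (auto simp: ht_t_pow_mult)
  moreover have "h0 \<otimes> s \<in> P"
    using h0 s by (force simp: P_def slab_def)
  then have "\<bar>ht (h0 \<otimes> s)\<bar> \<le> (\<Sum>h\<in>P. \<bar>ht h\<bar>)"
    using P by (intro member_le_sum) auto
  ultimately show "\<bar>ht (h \<otimes> s) - ht h\<bar> \<le> (\<Sum>h\<in>P. \<bar>ht h\<bar>)" by simp
qed

text \<open>Write \<open>g\<close> as a power of \<open>t\<close> times one of the finitely many
  \<open>s\<close> of height zero; then the slab at height \<open>ht g\<close> is the translate of
  \<open>slab 0 R\<close> by \<open>g \<otimes> inv s\<close>, so a finite set that serves every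
  \<open>s\<close> serves every \<open>g\<close>. This links slabs to translates by arbitrary group
  elements, with which ergodicity deals.\<close>

lemma translate_contains_slab:
  obtains F where "finite F" "F \<subseteq> carrier G"
    "\<And>g. g \<in> carrier G \<Longrightarrow> slab (ht g) (ht g + R) \<subseteq> (\<otimes>) g ` F"
proof
  define F where "F = (\<lambda>(s, w). inv s \<otimes> w) ` (slab 0 0 \<times> slab 0 R)"
  show "finite F" by (simp add: F_def)
  show "F \<subseteq> carrier G" by (auto simp: F_def slab_def)
  fix g assume g: "g \<in> carrier G"
  show "slab (ht g) (ht g + R) \<subseteq> (\<otimes>) g ` F"
  proof
    fix w assume w: "w \<in> slab (ht g) (ht g + R)"
    define s where "s = t [^] (- ht g) \<otimes> g"
    have s: "s \<in> slab 0 0"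
      using g ht_t_pow_mult[of g "- ht g"] by (auto simp: s_def slab_def)
    have w': "t [^] (- ht g) \<otimes> w \<in> slab 0 R"
      using w ht_t_pow_mult[of w "- ht g"] by (auto simp: slab_def)
    have wc: "w \<in> carrier G" using w by (auto simp: slab_def)
    have "inv s \<otimes> (t [^] (- ht g) \<otimes> w) = inv g \<otimes> w"
    proof -
      define c where "c = t [^] (- ht g)"
      have c: "c \<in> carrier G" by (simp add: c_def)
      have "inv s \<otimes> (c \<otimes> w) = inv g \<otimes> (inv c \<otimes> (c \<otimes> w))"
        using g wc c by (simp add: s_def inv_mult_group m_assoc flip: c_def)
      then show ?thesis
        using wc c by (simp add: c_def[symmetric] m_assoc[symmetric])
    qed
    then have "w = g \<otimes> (inv s \<otimes> (t [^] (- ht g) \<otimes> w))"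
      using g wc by (simp add: m_assoc[symmetric])
    then show "w \<in> (\<otimes>) g ` F" using s w' by (force simp: F_def)
  qed
qed

end

text \<open>Each right coset of the subgroup gets a representative, and the height of
  \<open>h\<close> is the integer matching the subgroup factor in front of it. Left multiplication
  by the generator \<open>t\<close> stays in the right coset and raises that integer by one.\<close>

lemma virtually_Z_imp_Z_height:
  fixes G :: "('g, 'm) monoid_scheme"
  assumes "group G" "virtually_Z G"
  obtains ht t where "Z_height G ht t"
proof -
  interpret group G by fact
  obtain H f where H: "subgroup H G" and fin: "finite (rcosets\<^bsub>G\<^esub> H)"
    and f: "f \<in> iso (G\<lparr>carrier := H\<rparr>) integer_group"
    using assms(2) by (auto simp: virtually_Z_def is_iso_def)
  have hom: "f (x \<otimes>\<^bsub>G\<^esub> y) = f x + f y" if "x \<in> H" "y \<in> H" for x y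
    using f that by (auto simp: iso_def hom_def)
  have bij: "bij_betw f H UNIV" using f by (auto simp: iso_def)
  obtain t where t: "t \<in> H" "f t = 1"
    using bij by (metis UNIV_I bij_betw_iff_bijections)
  have HG: "h \<in> carrier G" if "h \<in> H" for h using H that by (rule subgroup.mem_carrier)
  have f1: "f \<one>\<^bsub>G\<^esub> = 0"
    using hom[of "\<one>\<^bsub>G\<^esub>" "\<one>\<^bsub>G\<^esub>"] H by (simp add: subgroup.one_closed)
  \<comment> \<open>The choice looks only at the coset as a set, so all its elements share one
    representative.\<close>
  define rep where "rep h = (SOME r. r \<in> H #>\<^bsub>G\<^esub> h)" for h
  have rep: "rep h \<in> H #>\<^bsub>G\<^esub> h" if "h \<in> carrier G" for h
    unfolding rep_def using rcos_self[OF that H] by (rule someI)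
  have repG: "rep h \<in> carrier G" if "h \<in> carrier G" for h
    using rep[OF that] r_coset_subset_G[OF subgroup.subset[OF H] that] by blast
  have quot: "h \<otimes>\<^bsub>G\<^esub> inv\<^bsub>G\<^esub> rep h \<in> H" if h: "h \<in> carrier G" for h
  proof -
    obtain k where k: "k \<in> H" "rep h = k \<otimes>\<^bsub>G\<^esub> h"
      using rep[OF h] by (auto simp: r_coset_def)
    then have "h \<otimes>\<^bsub>G\<^esub> inv\<^bsub>G\<^esub> rep h = inv\<^bsub>G\<^esub> k"
      using h HG by (simp add: inv_mult_group flip: m_assoc)
    then show ?thesis using k H by (simp add: subgroup.m_inv_closed)
  qed
  define ht where "ht h = f (h \<otimes>\<^bsub>G\<^esub> inv\<^bsub>G\<^esub> rep h)" for h
  have "Z_height G ht t"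
  proof
    show "t \<in> carrier G" using t HG by blast
    show "ht (t \<otimes>\<^bsub>G\<^esub> h) = ht h + 1" if h: "h \<in> carrier G" for h
    proof -
      have "H #>\<^bsub>G\<^esub> (t \<otimes>\<^bsub>G\<^esub> h) = H #>\<^bsub>G\<^esub> h"
        using t HG h H by (simp add: coset_join2 subgroup.subset flip: coset_mult_assoc)
      then have "rep (t \<otimes>\<^bsub>G\<^esub> h) = rep h" by (simp add: rep_def)
      then show ?thesis
        using hom[OF t(1) quot[OF h]] t HG h repG[OF h] by (simp add: ht_def m_assoc)
    qed
    \<comment> \<open>Height zero forces the subgroup factor to be the identity, which leaves at
      most one element per coset.\<close>
    have "h = rep h" if h: "h \<in> carrier G" "ht h = 0" for h
    proof -
      have "h \<otimes>\<^bsub>G\<^esub> inv\<^bsub>G\<^esub> rep h = \<one>\<^bsub>G\<^esub>"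
        using h(2) f1 quot[OF h(1)] subgroup.one_closed[OF H] bij
        by (auto simp: ht_def bij_betw_def inj_on_def)
      then show ?thesis
        using h repG by (metis inv_closed inv_equality inv_inv)
    qed
    then have "{h \<in> carrier G. ht h = 0} \<subseteq> (\<lambda>c. SOME r. r \<in> c) ` (rcosets\<^bsub>G\<^esub> H)"
      unfolding rep_def RCOSETS_def by force
    then show "finite {h \<in> carrier G. ht h = 0}"
      using fin by (meson finite_imageI finite_subset)
  qed
  then show thesis by (rule that)
qed

section \<open>Cellular automata and orbit cylinders\<close>

lemma topspace_config_top: "topspace (config_top G A) = (\<Pi>\<^sub>E g\<in>carrier G. A)"
  by (simp add: config_top_def)

lemma openin_sets_config_borel:
  assumes "openin (config_top G A) U"
  shows "U \<in> sets (config_borel G A)"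
proof -
  have "{U. openin (config_top G A) U} \<subseteq> Pow (topspace (config_top G A))"
    by (auto dest: openin_subset)
  then show ?thesis
    using assms by (simp add: config_borel_def)
qed

lemma space_config_borel: "space (config_borel G A) = topspace (config_top G A)"
  unfolding config_borel_def by (rule space_measure_of) (auto dest: openin_subset)

lemma openin_coordinate:
  assumes "h \<in> carrier G"
  shows "openin (config_top G A) {x \<in> topspace (config_top G A). x h = a}"
proof (cases "a \<in> A")
  case True
  have "openin (config_top G A) {x \<in> topspace (config_top G A). x h \<in> {a}}"
    unfolding config_top_def using assms True
    by (intro openin_continuous_map_preimage[where Y = "discrete_topology A"]
        continuous_map_product_projection) auto
  then show ?thesis by simp
next
  \<comment> \<open>Values outside the alphabet have to be covered because \<open>C_sets\<close>
    allows an arbitrary centre \<open>x\<close>.\<close>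
  case False
  then have "{x \<in> topspace (config_top G A). x h = a} = {}"
    using assms by (auto simp: topspace_config_top)
  then show ?thesis by (simp only: openin_empty)
qed

section \<open>The shift action\<close>

context group
begin

lemma shift_closed:
  assumes "x \<in> topspace (config_top G A)" "g \<in> carrier G"
  shows "shift G g x \<in> topspace (config_top G A)"
  using assms by (auto simp: topspace_config_top shift_def)

lemma shift_apply:
  assumes "g \<in> carrier G" "h \<in> carrier G"
  shows "shift G g x (g \<otimes> h) = x h"
  using assms by (simp add: shift_def flip: m_assoc)

lemma shift_shift:
  assumes "g \<in> carrier G" "h \<in> carrier G"
  shows "shift G g (shift G h x) = shift G (g \<otimes> h) x"
  using assms by (auto simp: shift_def inv_mult_group m_assoc fun_eq_iff)

lemma shift_one:
  assumes "x \<in> topspace (config_top G A)"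
  shows "shift G \<one> x = x"
proof
  show "shift G \<one> x h = x h" for h
    using assms PiE_arb[of x "carrier G" "\<lambda>_. A" h]
    by (cases "h \<in> carrier G") (simp_all add: shift_def topspace_config_top)
qed

lemma shift_shift_inv:
  assumes "x \<in> topspace (config_top G A)" "g \<in> carrier G"
  shows "shift G g (shift G (inv g) x) = x" "shift G (inv g) (shift G g x) = x"
  using assms by (simp_all add: shift_shift shift_one)

text \<open>Invariance is defined through images of events, whereas measurability and push-forwards
  concern preimages; this translates between them.\<close>

lemma shift_image_vimage:
  assumes "E \<subseteq> topspace (config_top G A)" "g \<in> carrier G"
  shows "shift G (inv g) ` E = shift G g -` E \<inter> topspace (config_top G A)"
proof (intro equalityI subsetI)
  fix x assume "x \<in> shift G (inv g) ` E"
  then obtain y where y: "y \<in> E" "x = shift G (inv g) y" by blast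
  then show "x \<in> shift G g -` E \<inter> topspace (config_top G A)"
    using assms shift_shift_inv(1)[of y A g] shift_closed[of y A "inv g"] by auto
next
  fix x assume "x \<in> shift G g -` E \<inter> topspace (config_top G A)"
  then show "x \<in> shift G (inv g) ` E"
    using assms shift_shift_inv(2)[of x A g] by (intro image_eqI[where x = "shift G g x"]) auto
qed

end

section \<open>Iterates, orbit cylinders and the local rule\<close>

locale cellular = group G for G :: "('a, 'm) monoid_scheme" (structure) +
  fixes A :: "'b set" and \<phi> :: "('a \<Rightarrow> 'b) \<Rightarrow> 'a \<Rightarrow> 'b"
  assumes finite_alphabet: "finite A"
    and ca: "cellular_automaton G A \<phi>"
begin

abbreviation X where "X \<equiv> topspace (config_top G A)"

abbreviation C where "C x F \<equiv> orbit_cylinder G A x F \<phi>"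

lemma continuous_funpow: "continuous_map (config_top G A) (config_top G A) (\<phi> ^^ n)"
proof (induction n)
  case 0
  then show ?case by (simp add: id_def)
next
  case (Suc n)
  then show ?case
    using ca continuous_map_compose unfolding cellular_automaton_def funpow.simps by blast
qed

lemma funpow_closed: "x \<in> X \<Longrightarrow> (\<phi> ^^ n) x \<in> X"
  using continuous_funpow[of n] by (auto simp: continuous_map_def)

lemma funpow_shift:
  assumes "x \<in> X" "g \<in> carrier G"
  shows "(\<phi> ^^ n) (shift G g x) = shift G g ((\<phi> ^^ n) x)"
proof (induction n)
  case (Suc n)
  then show ?case
    using ca assms funpow_closed[OF assms(1), of n] by (simp add: cellular_automaton_def)
qed simp

lemma mem_C: "z \<in> C x F \<longleftrightarrow> z \<in> X \<and> (\<forall>n. \<forall>h\<in>F. (\<phi> ^^ n) z h = (\<phi> ^^ n) x h)"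
  unfolding orbit_cylinder_def by (auto simp: restrict_def fun_eq_iff)

lemma C_refl: "x \<in> X \<Longrightarrow> x \<in> C x F"
  by (simp add: mem_C)

lemma C_subset: "C x F \<subseteq> X"
  by (auto simp: mem_C)

text \<open>Having the same trace on \<open>F\<close> is an equivalence relation with the orbit
  cylinders as classes, so two of them are equal or disjoint.\<close>

lemma C_eqI: "z \<in> C x F \<Longrightarrow> C z F = C x F"
  by (auto simp: mem_C)

lemma C_antimono: "F \<subseteq> F' \<Longrightarrow> C x F' \<subseteq> C x F"
  by (auto simp: mem_C subset_iff)

lemma shift_C:
  assumes x: "x \<in> X" and g: "g \<in> carrier G" and F: "F \<subseteq> carrier G"
  shows "shift G g ` C x F = C (shift G g x) ((\<otimes>) g ` F)"
proof -
  \<comment> \<open>Kept general in \<open>g\<close>, since the reverse inclusion applies it to the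
    inverse.\<close>
  have *: "shift G g z \<in> C (shift G g x) ((\<otimes>) g ` F)"
    if "x \<in> X" "g \<in> carrier G" "F \<subseteq> carrier G" "z \<in> C x F" for x z g F
    using that by (auto simp: mem_C shift_closed funpow_shift shift_apply subset_iff)
  show ?thesis
  proof
    show "shift G g ` C x F \<subseteq> C (shift G g x) ((\<otimes>) g ` F)"
      using * assms by blast
    show "C (shift G g x) ((\<otimes>) g ` F) \<subseteq> shift G g ` C x F"
    proof
      fix z assume z: "z \<in> C (shift G g x) ((\<otimes>) g ` F)"
      then have zX: "z \<in> X" by (simp add: mem_C)
      have "(\<otimes>) (inv g) ` (\<otimes>) g ` F = F"
      proof -
        have "inv g \<otimes> (g \<otimes> h) = h" if "h \<in> F" for h
          using that F g by (auto simp flip: m_assoc)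
        then show ?thesis by (simp add: image_image)
      qed
      moreover have "(\<otimes>) g ` F \<subseteq> carrier G" using g F by auto
      ultimately have "shift G (inv g) z \<in> C x F"
        using *[of "shift G g x" "inv g" "(\<otimes>) g ` F" z] z g x
        by (simp add: shift_closed shift_shift_inv)
      moreover have "z = shift G g (shift G (inv g) z)"
        using zX g by (simp add: shift_shift_inv)
      ultimately show "z \<in> shift G g ` C x F" by blast
    qed
  qed
qed

text \<open>The Curtis--Hedlund--Lyndon theorem: by compactness finitely many cylinders on which the
  coordinate of the identity is constant cover the configuration space.\<close>

lemma local_rule:
  obtains S where "finite S" "S \<subseteq> carrier G"
    "\<And>x y h. x \<in> X \<Longrightarrow> y \<in> X \<Longrightarrow> h \<in> carrier G \<Longrightarrow> (\<And>s. s \<in> S \<Longrightarrow> x (h \<otimes> s) = y (h \<otimes> s))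
      \<Longrightarrow> \<phi> x h = \<phi> y h"
proof -
  define K where "K J x = {y \<in> X. \<forall>s\<in>J. y s = x s}" for J and x :: "'a \<Rightarrow> 'b"
  have "\<exists>J. finite J \<and> J \<subseteq> carrier G \<and> (\<forall>y\<in>K J x. \<phi> y \<one> = \<phi> x \<one>)" if x: "x \<in> X" for x
  proof -
    define U where "U = {y \<in> X. \<phi> y \<in> {y \<in> X. y \<one> = \<phi> x \<one>}}"
    have U: "openin (config_top G A) U"
      unfolding U_def using continuous_funpow[of 1]
      by (intro openin_continuous_map_preimage[where Y = "config_top G A"] openin_coordinate) auto
    have xU: "x \<in> U" using x funpow_closed[of x 1] by (simp add: U_def)
    obtain Y where Y: "x \<in> (\<Pi>\<^sub>E i\<in>carrier G. Y i)" "finite {i. Y i \<noteq> A}" "(\<Pi>\<^sub>E i\<in>carrier G. Y i) \<subseteq> U"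
      using product_topology_open_contains_basis[OF U[unfolded config_top_def] xU] by auto
    \<comment> \<open>The coordinates on which the basic open box around \<open>x\<close> imposes a
      condition.\<close>
    define J where "J = {i. Y i \<noteq> A} \<inter> carrier G"
    have "y \<in> (\<Pi>\<^sub>E i\<in>carrier G. Y i)" if "y \<in> K J x" for y
    proof (rule PiE_I)
      have y: "y \<in> (\<Pi>\<^sub>E i\<in>carrier G. A)" "\<forall>i\<in>J. y i = x i"
        using that by (auto simp: K_def topspace_config_top)
      show "y i \<in> Y i" if "i \<in> carrier G" for i
        using PiE_mem[OF y(1) that] PiE_mem[OF Y(1) that] y(2) that
        by (cases "Y i = A") (auto simp: J_def)
      show "y i = undefined" if "i \<notin> carrier G" for i
        using PiE_arb[OF y(1) that] .
    qed
    then have "K J x \<subseteq> U" using Y(3) by blast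
    then have "\<forall>y\<in>K J x. \<phi> y \<one> = \<phi> x \<one>" by (auto simp: U_def)
    then show ?thesis using Y(2) by (intro exI[of _ J]) (auto simp: J_def)
  qed
  then obtain J where J: "\<And>x. x \<in> X \<Longrightarrow> finite (J x)" "\<And>x. x \<in> X \<Longrightarrow> J x \<subseteq> carrier G"
    "\<And>x y. x \<in> X \<Longrightarrow> y \<in> K (J x) x \<Longrightarrow> \<phi> y \<one> = \<phi> x \<one>"
    by metis
  have K_open: "openin (config_top G A) (K (J x) x)" if x: "x \<in> X" for x
  proof -
    have "K (J x) x = X \<inter> (\<Inter>s\<in>J x. {y \<in> X. y s = x s})" by (auto simp: K_def)
    also have "openin (config_top G A) \<dots>"
      using J[OF x] by (cases "J x = {}") (auto intro!: openin_Int openin_INT openin_coordinate)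
    finally show ?thesis .
  qed
  have "compact_space (config_top G A)"
    unfolding config_top_def compact_space_product_topology
    using finite_alphabet by (simp add: compact_space_discrete_topology)
  moreover have "X \<subseteq> \<Union>((\<lambda>x. K (J x) x) ` X)" by (auto simp: K_def)
  ultimately obtain \<F> where \<F>: "finite \<F>" "\<F> \<subseteq> (\<lambda>x. K (J x) x) ` X" "X \<subseteq> \<Union>\<F>"
    unfolding compact_space_alt using K_open
    by (elim allE[where x = "(\<lambda>x. K (J x) x) ` X"]) auto
  obtain Y where Y: "Y \<subseteq> X" "finite Y" "\<F> = (\<lambda>x. K (J x) x) ` Y"
    using finite_subset_image[OF \<F>(1,2)] by blast
  define S where "S = (\<Union>x\<in>Y. J x)"
  have fS: "finite S" and SG: "S \<subseteq> carrier G" using Y J by (auto simp: S_def)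
  \<comment> \<open>If \<open>x\<close> and \<open>y\<close> agree on \<open>S\<close>, they lie in
    a common cylinder of the finite subcover, because each of these tests coordinates in
    \<open>S\<close> only.\<close>
  have S: "\<phi> x \<one> = \<phi> y \<one>" if xy: "x \<in> X" "y \<in> X" "\<And>s. s \<in> S \<Longrightarrow> x s = y s" for x y
  proof -
    obtain z where z: "z \<in> Y" "x \<in> K (J z) z" using \<F>(3) Y(3) xy(1) by auto
    have "y s = z s" if "s \<in> J z" for s
    proof -
      have "x s = y s" using xy(3) z(1) that by (auto simp: S_def)
      then show ?thesis using z(2) that by (simp add: K_def)
    qed
    then have "y \<in> K (J z) z" using xy(2) by (simp add: K_def)
    then show ?thesis using J(3)[of z] z Y(1) by (metis subsetD)
  qed
  \<comment> \<open>Equivariance moves the value at \<open>h\<close> to the identity.\<close>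
  have at: "\<phi> x h = \<phi> (shift G (inv h) x) \<one>" if "x \<in> X" "h \<in> carrier G" for x h
    using funpow_shift[of x "inv h" 1] that by (simp add: shift_def)
  show thesis
  proof (rule that[OF fS SG])
    fix x y h assume *: "x \<in> X" "y \<in> X" "h \<in> carrier G" "\<And>s. s \<in> S \<Longrightarrow> x (h \<otimes> s) = y (h \<otimes> s)"
    have "\<phi> (shift G (inv h) x) \<one> = \<phi> (shift G (inv h) y) \<one>"
    proof (rule S)
      show "shift G (inv h) x \<in> X" "shift G (inv h) y \<in> X" using * by (simp_all add: shift_closed)
      show "shift G (inv h) x s = shift G (inv h) y s" if "s \<in> S" for s
        using * SG that by (auto simp: shift_def)
    qed
    then show "\<phi> x h = \<phi> y h" using at * by simp
  qed
qed

end

section \<open>Orbit cylinders of positive measure\<close>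

lemma (in finite_measure) countable_nonnull_disjoint:
  assumes "\<C> \<subseteq> sets M" "disjoint \<C>"
  shows "countable {c \<in> \<C>. emeasure M c \<noteq> 0}"
proof -
  \<comment> \<open>Finite partial sums are bounded by the total measure, and a summable family has
    only countably many nonzero terms.\<close>
  have "measure M summable_on \<C>"
  proof (rule nonneg_bdd_above_summable_on)
    show "bdd_above (sum (measure M) ` {F. F \<subseteq> \<C> \<and> finite F})"
    proof (rule bdd_aboveI2)
      fix F assume F: "F \<in> {F. F \<subseteq> \<C> \<and> finite F}"
      have "disjoint_family_on (\<lambda>c. c) F"
        using assms(2) F by (auto simp: disjoint_family_on_def pairwise_def disjnt_def)
      then have "sum (measure M) F = measure M (\<Union>c\<in>F. c)"
        using F assms(1) by (intro finite_measure_finite_Union[symmetric]) auto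
      also have "\<dots> \<le> measure M (space M)" by (rule bounded_measure)
      finally show "sum (measure M) F \<le> measure M (space M)" .
    qed
  qed simp
  then have "countable {c \<in> \<C>. measure M c \<noteq> 0}" by (rule summable_countable_real)
  then show ?thesis by (simp add: emeasure_eq_measure)
qed

text \<open>The null members of a countable family have a null union.\<close>

lemma AE_positive_cells:
  assumes "countable \<F>" "\<F> \<subseteq> sets M"
  shows "AE x in M. \<forall>E\<in>\<F>. x \<in> E \<longrightarrow> emeasure M E \<noteq> 0"
proof -
  have "AE x in M. x \<in> E \<longrightarrow> emeasure M E \<noteq> 0" if "E \<in> \<F>" for E
  proof (cases "emeasure M E = 0")
    case True
    then have "E \<in> null_sets M" using that assms(2) by blast
    then have "AE x in M. x \<notin> E" by (rule AE_not_in)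
    then show ?thesis by eventually_elim simp
  qed simp
  then show ?thesis using assms(1) by (simp add: AE_ball_countable)
qed

locale cellular_measure = cellular G A \<phi>
  for G :: "('a, 'm) monoid_scheme" (structure) and A :: "'b set" and \<phi> +
  fixes \<mu> :: "('a \<Rightarrow> 'b) measure"
  assumes config_prob: "config_prob G A \<mu>"
begin

sublocale prob_space \<mu>
  using config_prob by (simp add: config_prob_def)

lemma sets_\<mu>: "sets \<mu> = sets (config_borel G A)"
  using config_prob by (simp add: config_prob_def)

lemma space_\<mu>: "space \<mu> = X"
  using sets_eq_imp_space_eq[OF sets_\<mu>] by (simp add: space_config_borel)

lemma coordinate_sets:
  assumes "h \<in> carrier G"
  shows "{z \<in> X. (\<phi> ^^ n) z h = a} \<in> sets \<mu>"
proof -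
  have "openin (config_top G A) {z \<in> X. (\<phi> ^^ n) z \<in> {z \<in> X. z h = a}}"
    by (rule openin_continuous_map_preimage[OF continuous_funpow openin_coordinate[OF assms]])
  moreover have "{z \<in> X. (\<phi> ^^ n) z \<in> {z \<in> X. z h = a}} = {z \<in> X. (\<phi> ^^ n) z h = a}"
    using funpow_closed by auto
  ultimately show ?thesis by (simp add: sets_\<mu> openin_sets_config_borel)
qed

lemma C_sets:
  assumes "finite F" "F \<subseteq> carrier G"
  shows "C x F \<in> sets \<mu>"
proof -
  \<comment> \<open>The factor \<open>space \<mu>\<close> keeps the inner intersection inside the
    space when \<open>F\<close> is empty.\<close>
  have "C x F = (\<Inter>n. space \<mu> \<inter> (\<Inter>h\<in>F. {z \<in> X. (\<phi> ^^ n) z h = (\<phi> ^^ n) x h}))"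
    by (auto simp: mem_C space_\<mu>)
  moreover have "space \<mu> \<inter> (\<Inter>h\<in>F. {z \<in> X. (\<phi> ^^ n) z h = (\<phi> ^^ n) x h}) \<in> sets \<mu>" for n
    using assms coordinate_sets by (cases "F = {}") (auto intro!: sets.Int sets.finite_INT)
  ultimately show ?thesis by (metis (no_types, lifting) UNIV_not_empty image_subsetI sets.countable_INT)
qed

text \<open>Cylinders are collected as sets and not by their centres; many centres share a cell,
  which is why the family can be countable.\<close>

definition cells :: "'a set \<Rightarrow> ('a \<Rightarrow> 'b) set set" where
  "cells F = {c \<in> (\<lambda>x. C x F) ` X. emeasure \<mu> c \<noteq> 0}"

definition P :: "'a set \<Rightarrow> ('a \<Rightarrow> 'b) set" where
  "P F = {x \<in> X. emeasure \<mu> (C x F) \<noteq> 0}"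

lemma cells_sets: "finite F \<Longrightarrow> F \<subseteq> carrier G \<Longrightarrow> cells F \<subseteq> sets \<mu>"
  by (auto simp: cells_def C_sets)

lemma countable_cells:
  assumes "finite F" "F \<subseteq> carrier G"
  shows "countable (cells F)"
  unfolding cells_def
proof (rule countable_nonnull_disjoint)
  show "(\<lambda>x. C x F) ` X \<subseteq> sets \<mu>" using assms C_sets by blast
  show "disjoint ((\<lambda>x. C x F) ` X)"
  proof (rule disjointI)
    fix a b assume "a \<in> (\<lambda>x. C x F) ` X" "b \<in> (\<lambda>x. C x F) ` X" "a \<noteq> b"
    then show "a \<inter> b = {}" using C_eqI by blast
  qed
qed

text \<open>Gives the measurability of \<open>P F\<close>, as a countable union of measurable
  cells.\<close>

lemma P_eq_Union_cells: "P F = \<Union>(cells F)"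
proof (intro equalityI subsetI)
  fix x assume "x \<in> P F"
  then have "C x F \<in> cells F" "x \<in> C x F" by (auto simp: P_def cells_def C_refl)
  then show "x \<in> \<Union>(cells F)" by blast
next
  fix x assume "x \<in> \<Union>(cells F)"
  then obtain y where y: "x \<in> C y F" "emeasure \<mu> (C y F) \<noteq> 0" by (auto simp: cells_def)
  then show "x \<in> P F" using C_eqI[OF y(1)] C_subset by (auto simp: P_def)
qed

lemma P_sets: "finite F \<Longrightarrow> F \<subseteq> carrier G \<Longrightarrow> P F \<in> sets \<mu>"
  unfolding P_eq_Union_cells using countable_cells cells_sets by (blast intro: sets.countable_Union)

lemma P_antimono:
  assumes "F \<subseteq> F'" "finite F" "F' \<subseteq> carrier G"
  shows "P F' \<subseteq> P F"
proof
  fix x assume x: "x \<in> P F'"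
  have "emeasure \<mu> (C x F') \<le> emeasure \<mu> (C x F)"
    using assms by (intro emeasure_mono C_antimono C_sets) auto
  then show "x \<in> P F" using x by (auto simp: P_def)
qed

text \<open>If \<open>P F\<close> were null, \<open>F\<close> itself would witness
  sensitivity.\<close>

lemma P_nonnull:
  assumes "\<not> mu_sensitive G A \<mu> \<phi>" "finite F" "F \<subseteq> carrier G"
  shows "emeasure \<mu> (P F) \<noteq> 0"
proof
  assume "emeasure \<mu> (P F) = 0"
  then have "AE x in \<mu>. x \<notin> P F"
    using P_sets[OF assms(2,3)] by (intro AE_not_in) blast
  then have "AE x in \<mu>. emeasure \<mu> (C x F) = 0"
    by (rule AE_mp) (auto simp: P_def space_\<mu>)
  then show False using assms by (auto simp: mu_sensitive_def)
qed

end

section \<open>Translation of cylinders under an invariant measure\<close>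

locale invariant_cellular = cellular_measure +
  assumes invariant: "shift_invariant G A \<mu>"
begin

lemma emeasure_shift:
  assumes "g \<in> carrier G" "E \<in> sets \<mu>"
  shows "emeasure \<mu> (shift G g ` E) = emeasure \<mu> E"
  using invariant assms inv_closed[OF assms(1)] inv_inv[OF assms(1)]
  unfolding shift_invariant_def by metis

text \<open>The shift carries cylinders to cylinders of the same measure; the reverse inclusion
  comes from the inverse element.\<close>

lemma shift_P:
  assumes g: "g \<in> carrier G" and F: "finite F" "F \<subseteq> carrier G"
  shows "shift G g ` P F = P ((\<otimes>) g ` F)"
proof -
  have mono: "shift G g ` P F \<subseteq> P ((\<otimes>) g ` F)" if g: "g \<in> carrier G" and F: "finite F" "F \<subseteq> carrier G" for g F
  proof
    fix z assume "z \<in> shift G g ` P F"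
    then obtain x where x: "x \<in> X" "emeasure \<mu> (C x F) \<noteq> 0" "z = shift G g x" by (auto simp: P_def)
    then show "z \<in> P ((\<otimes>) g ` F)"
      using emeasure_shift[OF g C_sets[OF F, of x]] shift_C[OF x(1) g F(2)] shift_closed[OF x(1) g]
      by (simp add: P_def)
  qed
  have "P ((\<otimes>) g ` F) = shift G g ` shift G (inv g) ` P ((\<otimes>) g ` F)"
    using shift_shift_inv(1)[OF _ g, of _ A] by (force simp: image_image P_def)
  also have "\<dots> \<subseteq> shift G g ` P ((\<otimes>) (inv g) ` (\<otimes>) g ` F)"
    using g F by (intro image_mono mono) auto
  also have "(\<otimes>) (inv g) ` (\<otimes>) g ` F = F"
  proof -
    have "inv g \<otimes> (g \<otimes> h) = h" if "h \<in> F" for h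
      using that F g by (auto simp flip: m_assoc)
    then show ?thesis by (simp add: image_image)
  qed
  finally show ?thesis using mono[OF g F] by blast
qed

end

section \<open>The dichotomy for ergodic measures\<close>

locale invariant_Z_cellular = Z_height G ht t + invariant_cellular G A \<phi> \<mu>
  for G :: "('a, 'm) monoid_scheme" (structure) and ht t and A :: "'b set" and \<phi> \<mu>
begin

lemma AE_one_sided_union:
  fixes R :: int
  defines "Q D \<equiv> \<Union>n\<in>D. P (slab n (n + R))"
  assumes full: "emeasure \<mu> (Q UNIV) = 1"
  shows "AE y in \<mu>. \<forall>N. y \<in> Q {N..} \<and> y \<in> Q {..N}"
proof -
  have Q_sets: "Q D \<in> sets \<mu>" for D
    unfolding Q_def by (intro sets.countable_UN'' P_sets slab_subset) auto
  have shift_Q: "shift G (t [^] k) ` Q D = Q ((+) k ` D)" for k D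
    unfolding Q_def image_UN
    by (simp add: shift_P slab_subset translate_slab algebra_simps)
  have Q_translate: "emeasure \<mu> (Q ((+) k ` D)) = emeasure \<mu> (Q D)" for k D
    using emeasure_shift[OF _ Q_sets, of "t [^] k" D] by (simp add: shift_Q)
  \<comment> \<open>Covers upward and downward rays alike: the \<open>E i\<close> are translates of
    \<open>D\<close> that exhaust the integers, so continuity from below gives \<open>Q D\<close>
    the full measure.\<close>
  have AE_Q: "AE y in \<mu>. y \<in> Q D"
    if "\<And>i. \<exists>k. E i = (+) k ` D" "incseq E" "(\<Union>i. E i) = UNIV" for D and E :: "nat \<Rightarrow> int set"
  proof -
    have "emeasure \<mu> (Q (E i)) = emeasure \<mu> (Q D)" for i
      using that(1)[of i] Q_translate by auto
    moreover have "(SUP i. emeasure \<mu> (Q (E i))) = emeasure \<mu> (\<Union>i. Q (E i))"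
    proof (rule SUP_emeasure_incseq)
      show "range (\<lambda>i. Q (E i)) \<subseteq> sets \<mu>" using Q_sets by auto
      show "incseq (\<lambda>i. Q (E i))" using that(2) by (fastforce simp: incseq_def Q_def)
    qed
    moreover have "(\<Union>i. Q (E i)) = Q (\<Union>i. E i)" by (auto simp: Q_def)
    ultimately have "emeasure \<mu> (Q D) = 1" using full that(3) by simp
    then show ?thesis using AE_prob_1[of "Q D"] by (simp add: emeasure_eq_measure)
  qed
  have "AE y in \<mu>. y \<in> Q {N..}" for N
  proof (rule AE_Q[of "\<lambda>i. {N - int i..}"])
    show "\<exists>k. {N - int i..} = (+) k ` {N..}" for i
      by (intro exI[of _ "- int i"]) (simp only: image_add_atLeast, simp)
    have "x \<in> {N - int (nat \<bar>x - N\<bar>)..}" for x by simp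
    then show "(\<Union>i. {N - int i..}) = UNIV" by blast
  qed (auto simp: incseq_def)
  moreover have "AE y in \<mu>. y \<in> Q {..N}" for N
  proof (rule AE_Q[of "\<lambda>i. {..N + int i}"])
    show "\<exists>k. {..N + int i} = (+) k ` {..N}" for i
      by (intro exI[of _ "int i"]) (simp only: image_add_atMost add.commute)
    have "x \<in> {..N + int (nat \<bar>x - N\<bar>)}" for x by simp
    then show "(\<Union>i. {..N + int i}) = UNIV" by blast
  qed (auto simp: incseq_def)
  ultimately show ?thesis by (simp add: AE_all_countable)
qed

text \<open>The slabs \<^term>\<open>slab a (a + R)\<close> and \<^term>\<open>slab b (b + R)\<close> act as walls: no information crosses them, so
  between them the evolution is determined by their traces and the initial word.\<close>

lemma wall:
  assumes R: "\<And>h s. h \<in> carrier G \<Longrightarrow> s \<in> S \<Longrightarrow> \<bar>ht (h \<otimes> s) - ht h\<bar> \<le> R"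
    and S: "S \<subseteq> carrier G"
    and loc: "\<And>x y h. x \<in> X \<Longrightarrow> y \<in> X \<Longrightarrow> h \<in> carrier G \<Longrightarrow> (\<And>s. s \<in> S \<Longrightarrow> x (h \<otimes> s) = y (h \<otimes> s))
      \<Longrightarrow> \<phi> x h = \<phi> y h"
    and y: "y \<in> X"
    and z: "z \<in> C y (slab a (a + R))" "z \<in> C y (slab b (b + R))"
    and zy: "\<And>h. h \<in> slab a (b + R) \<Longrightarrow> z h = y h"
  shows "z \<in> C y (slab a (b + R))"
proof -
  have "\<forall>h\<in>slab a (b + R). (\<phi> ^^ n) z h = (\<phi> ^^ n) y h" for n
  proof (induction n)
    case 0
    then show ?case using zy by simp
  next
    case (Suc n)
    show ?case
    proof
      fix h assume h: "h \<in> slab a (b + R)"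
      \<comment> \<open>On the walls agreement is given at all times. Strictly between them a
        neighbour \<open>h \<otimes> s\<close> differs in height by at most \<open>R\<close>, so it
        stays within \<open>slab a (b + R)\<close>, where the induction hypothesis applies.\<close>
      consider "h \<in> slab a (a + R)" | "h \<in> slab b (b + R)" | "a + R < ht h" "ht h < b"
        using h by (force simp: slab_def)
      then show "(\<phi> ^^ Suc n) z h = (\<phi> ^^ Suc n) y h"
      proof cases
        case 1
        then show ?thesis using z unfolding mem_C by blast
      next
        case 2
        then show ?thesis using z unfolding mem_C by blast
      next
        case 3
        have hG: "h \<in> carrier G" using h by (simp add: slab_def)
        have "h \<otimes> s \<in> slab a (b + R)" if "s \<in> S" for s
          using R[OF hG that] 3 hG S that by (auto simp: slab_def)
        then have "\<phi> ((\<phi> ^^ n) z) h = \<phi> ((\<phi> ^^ n) y) h"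
          using Suc z y hG by (intro loc funpow_closed) (auto simp: mem_C)
        then show ?thesis by simp
      qed
    qed
  qed
  then show ?thesis using z by (simp add: mem_C)
qed

end

locale ergodic_Z_cellular = invariant_Z_cellular +
  assumes ergodic: "shift_ergodic G A \<mu>"
begin

text \<open>Ergodicity needs an event invariant under all of \<open>G\<close>, but translates of
  slabs need not be slabs. The union \<open>V\<close> over all translates of a finite
  \<open>F\<close> is invariant and non-null, hence full, and it lies in the slab event because
  every translate of \<open>F\<close> contains a slab.\<close>

lemma full_slabs:
  assumes "\<not> mu_sensitive G A \<mu> \<phi>"
  shows "emeasure \<mu> (\<Union>n. P (slab n (n + R))) = 1"
proof -
  obtain F where F: "finite F" "F \<subseteq> carrier G"
    and FR: "\<And>g. g \<in> carrier G \<Longrightarrow> slab (ht g) (ht g + R) \<subseteq> (\<otimes>) g ` F"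
    using translate_contains_slab by blast
  define V where "V = (\<Union>g\<in>carrier G. P ((\<otimes>) g ` F))"
  have gF: "finite ((\<otimes>) g ` F)" "(\<otimes>) g ` F \<subseteq> carrier G" if "g \<in> carrier G" for g
    using F that by auto
  have V_sets: "V \<in> sets \<mu>"
    unfolding V_def using gF countable_carrier by (intro sets.countable_UN'' P_sets)
  have shift_V: "shift G g ` V \<subseteq> V" if g: "g \<in> carrier G" for g
  proof -
    have "shift G g ` P ((\<otimes>) h ` F) = P ((\<otimes>) (g \<otimes> h) ` F)" if h: "h \<in> carrier G" for h
    proof -
      have "(\<otimes>) g ` (\<otimes>) h ` F = (\<otimes>) (g \<otimes> h) ` F"
        unfolding image_image using g h F by (intro image_cong) (auto simp: m_assoc)
      then show ?thesis using shift_P[OF g gF[OF h]] by simp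
    qed
    then show ?thesis using g by (auto simp: V_def image_UN)
  qed
  have "V \<subseteq> shift G (inv g) ` V" if g: "g \<in> carrier G" for g
  proof -
    have "V \<subseteq> X" using V_sets sets.sets_into_space space_\<mu> by metis
    then have "V = shift G (inv g) ` shift G g ` V"
      using shift_shift_inv(2)[OF _ g, of _ A] by (force simp: image_image)
    then show ?thesis using shift_V[OF g] by blast
  qed
  then have "emeasure \<mu> V \<in> {0, 1}"
    using ergodic V_sets shift_V unfolding shift_ergodic_def by (metis inv_closed subset_antisym)
  moreover have "P ((\<otimes>) \<one> ` F) \<subseteq> V" by (auto simp: V_def)
  then have "emeasure \<mu> V \<noteq> 0"
    using P_nonnull[OF assms gF[OF one_closed]] emeasure_mono[OF _ V_sets] by (metis le_zero_eq)
  ultimately have V1: "emeasure \<mu> V = 1" by simp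
  have "V \<subseteq> (\<Union>n. P (slab n (n + R)))"
  proof
    fix x assume "x \<in> V"
    then obtain g where g: "g \<in> carrier G" "x \<in> P ((\<otimes>) g ` F)" by (auto simp: V_def)
    then have "x \<in> P (slab (ht g) (ht g + R))"
      using P_antimono[OF FR] gF by fastforce
    then show "x \<in> (\<Union>n. P (slab n (n + R)))" by blast
  qed
  moreover have "(\<Union>n. P (slab n (n + R))) \<in> sets \<mu>"
    by (intro sets.countable_UN'' P_sets slab_subset) auto
  ultimately have "emeasure \<mu> V \<le> emeasure \<mu> (\<Union>n. P (slab n (n + R)))"
    by (rule emeasure_mono)
  then show ?thesis using V1 emeasure_le_1 by (metis antisym)
qed

theorem sensitive_or_equicontinuous:
  "mu_sensitive G A \<mu> \<phi> \<or> mu_equicontinuous G A \<mu> \<phi>"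
proof -
  have "mu_equicontinuous G A \<mu> \<phi>" if ns: "\<not> mu_sensitive G A \<mu> \<phi>"
  proof -
  obtain S where S: "finite S" "S \<subseteq> carrier G"
    and loc: "\<And>x y h. x \<in> X \<Longrightarrow> y \<in> X \<Longrightarrow> h \<in> carrier G \<Longrightarrow> (\<And>s. s \<in> S \<Longrightarrow> x (h \<otimes> s) = y (h \<otimes> s))
      \<Longrightarrow> \<phi> x h = \<phi> y h"
    using local_rule by blast
  obtain R where R0: "R \<ge> 0"
    and R: "\<And>h s. h \<in> carrier G \<Longrightarrow> s \<in> S \<Longrightarrow> \<bar>ht (h \<otimes> s) - ht h\<bar> \<le> R"
    using ht_mult_bound[OF S] by blast
  define D where "D K u = {z \<in> X. \<forall>h\<in>K. z h = u h}" for K u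
  \<comment> \<open>A member prescribes the traces on both walls and the initial word from one wall
    to the other. There are countably many cells and, the alphabet being finite, finitely many
    words.\<close>
  define \<F> where "\<F> a b = (\<lambda>((c, d), e). c \<inter> d \<inter> e) `
      ((cells (slab a (a + R)) \<times> cells (slab b (b + R))) \<times>
        D (slab a (b + R)) ` (\<Pi>\<^sub>E h\<in>slab a (b + R). A))" for a b
  have D_sets: "D (slab a b) u \<in> sets \<mu>" for a b u
  proof -
    have "D (slab a b) u = X \<inter> (\<Inter>h\<in>slab a b. {z \<in> X. (\<phi> ^^ 0) z h = u h})" by (auto simp: D_def)
    also have "\<dots> \<in> sets \<mu>"
      using coordinate_sets[OF subsetD[OF slab_subset], of _ a b 0] sets.top[of \<mu>]
      by (cases "slab a b = {}") (auto simp: space_\<mu>)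
    finally show ?thesis .
  qed
  have "countable (\<F> a b)" for a b
    unfolding \<F>_def using finite_alphabet
    by (intro countable_image countable_SIGMA countable_cells slab_subset)
      (auto intro!: countable_finite finite_PiE)
  moreover have "\<F> a b \<subseteq> sets \<mu>" for a b
  proof
    fix E assume "E \<in> \<F> a b"
    then obtain c d u where "c \<in> cells (slab a (a + R))" "d \<in> cells (slab b (b + R))"
      "E = c \<inter> d \<inter> D (slab a (b + R)) u"
      unfolding \<F>_def by auto
    moreover have "cells (slab k (k + R)) \<subseteq> sets \<mu>" for k
      by (intro cells_sets finite_slab slab_subset)
    ultimately show "E \<in> sets \<mu>" using D_sets by blast
  qed
  \<comment> \<open>As \<open>a\<close> and \<open>b\<close> range over a countable set, one null
    set serves all pairs of walls, before \<open>F\<close> is chosen.\<close>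
  ultimately have "AE y in \<mu>. \<forall>a b. \<forall>E\<in>\<F> a b. y \<in> E \<longrightarrow> emeasure \<mu> E \<noteq> 0"
    unfolding AE_all_countable by (intro allI AE_positive_cells)
  moreover have "AE y in \<mu>. \<forall>N. y \<in> (\<Union>n\<in>{N..}. P (slab n (n + R))) \<and> y \<in> (\<Union>n\<in>{..N}. P (slab n (n + R)))"
    using full_slabs[OF ns] by (rule AE_one_sided_union)
  ultimately have "AE y in \<mu>. \<forall>F. finite F \<and> F \<subseteq> carrier G \<longrightarrow> emeasure \<mu> (C y F) > 0"
  proof eventually_elim
    case (elim y)
    show ?case
    proof (intro allI impI)
      fix F assume F: "finite F \<and> F \<subseteq> carrier G"
      then obtain N where N: "F \<subseteq> slab (- N) N" using finite_subset_slab by blast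
      obtain b where b: "b \<ge> N" "y \<in> P (slab b (b + R))" using elim(2) by blast
      obtain a where a: "a \<le> - N" "y \<in> P (slab a (a + R))" using elim(2) by blast
      have yX: "y \<in> X" using a by (simp add: P_def)
      define E where "E = C y (slab a (a + R)) \<inter> C y (slab b (b + R)) \<inter>
        D (slab a (b + R)) (restrict y (slab a (b + R)))"
      have "C y (slab a (a + R)) \<in> cells (slab a (a + R))" "C y (slab b (b + R)) \<in> cells (slab b (b + R))"
        using a b by (auto simp: P_def cells_def)
      \<comment> \<open>The words indexing the family are extensional functions, hence the
        restriction.\<close>
      moreover have "restrict y (slab a (b + R)) \<in> (\<Pi>\<^sub>E h\<in>slab a (b + R). A)"
        using yX slab_subset by (auto simp: topspace_config_top)
      ultimately have "E \<in> \<F> a b" unfolding \<F>_def E_def by force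
      moreover have "y \<in> E" using yX by (auto simp: E_def D_def C_refl)
      ultimately have "emeasure \<mu> E \<noteq> 0" using elim(1) by blast
      moreover have "E \<subseteq> C y F"
      proof
        fix z assume z: "z \<in> E"
        have "z \<in> C y (slab a (a + R))" "z \<in> C y (slab b (b + R))"
          "\<And>h. h \<in> slab a (b + R) \<Longrightarrow> z h = y h"
          using z by (auto simp: E_def D_def)
        with R S(2) loc yX have "z \<in> C y (slab a (b + R))" by (rule wall)
        \<comment> \<open>\<open>R \<ge> 0\<close> enters here: \<open>F\<close> reaches up to
          \<open>N \<le> b \<le> b + R\<close>.\<close>
        moreover have "F \<subseteq> slab a (b + R)" using N a b R0 by (force simp: slab_def)
        ultimately show "z \<in> C y F" using C_antimono by blast
      qed
      then have "emeasure \<mu> E \<le> emeasure \<mu> (C y F)"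
        using F by (intro emeasure_mono C_sets) auto
      ultimately show "emeasure \<mu> (C y F) > 0" by (metis le_zero_eq not_gr_zero)
    qed
  qed
  then show ?thesis by (simp add: mu_equicontinuous_def)
  qed
  then show ?thesis by blast
qed

end

section \<open>Bernoulli measures are ergodic\<close>

text \<open>Tannery's theorem makes pointwise convergence of dominated set functions a property that
  passes from a generating \<pi>-system to the \<sigma>-algebra.\<close>

lemma tendsto_sigma_sets_dominated:
  fixes f :: "nat \<Rightarrow> 'a set \<Rightarrow> real" and l :: "'a set \<Rightarrow> real"
  assumes "finite_measure M"
    and gen: "Int_stable \<G>" "\<G> \<subseteq> Pow (space M)" "sets M = sigma_sets (space M) \<G>"
    and bound: "\<And>n B. B \<in> sets M \<Longrightarrow> \<bar>f n B\<bar> \<le> measure M B"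
    and sums: "\<And>n B. range B \<subseteq> sets M \<Longrightarrow> disjoint_family B \<Longrightarrow> (\<lambda>i. f n (B i)) sums f n (\<Union>i. B i)"
      "\<And>B. range B \<subseteq> sets M \<Longrightarrow> disjoint_family B \<Longrightarrow> (\<lambda>i. l (B i)) sums l (\<Union>i. B i)"
    and compl: "\<And>n B. B \<in> sets M \<Longrightarrow> f n (space M - B) = f n (space M) - f n B"
      "\<And>B. B \<in> sets M \<Longrightarrow> l (space M - B) = l (space M) - l B"
    and space: "(\<lambda>n. f n (space M)) \<longlonglongrightarrow> l (space M)"
    and conv: "\<And>B. B \<in> \<G> \<Longrightarrow> (\<lambda>n. f n B) \<longlonglongrightarrow> l B"
    and B: "B \<in> sets M"
  shows "(\<lambda>n. f n B) \<longlonglongrightarrow> l B"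
proof -
  interpret finite_measure M by fact
  have "B \<in> sigma_sets (space M) \<G>" using B gen(3) by simp
  with gen(1,2) show ?thesis
  proof (induction rule: sigma_sets_induct_disjoint)
    case (basic B)
    then show ?case by (rule conv)
  next
    case empty
    have "l {} = 0"
      using compl(2)[of "space M"] by simp
    moreover have "f n {} = 0" for n
      using compl(1)[of "space M" n] by simp
    ultimately show ?case by simp
  next
    case (compl B)
    then have "B \<in> sets M" by (simp add: gen(3))
    then show ?case
      using tendsto_diff[OF space compl.IH] assms(8,9) by simp
  next
    case (union B)
    have B: "range B \<subseteq> sets M" "disjoint_family B" using union by (auto simp: gen(3))
    \<comment> \<open>The dominating terms \<open>measure M (B i)\<close> have a finite sum by
      disjointness.\<close>
    have "(\<lambda>n. \<Sum>i. f n (B i)) \<longlonglongrightarrow> (\<Sum>i. l (B i))"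
    proof (rule tannerys_theorem[THEN conjunct2, THEN conjunct2])
      show "(\<lambda>n. f n (B i)) \<longlonglongrightarrow> l (B i)" for i using union.IH .
      show "\<forall>\<^sub>F (i, n) in sequentially \<times>\<^sub>F sequentially. norm (f n (B i)) \<le> measure M (B i)"
        using B bound by (auto intro!: always_eventually)
      show "summable (\<lambda>i. measure M (B i))"
        using finite_measure_UNION[OF B] by (rule sums_summable)
    qed simp
    then show ?case using sums(1)[OF B] sums(2)[OF B] by (simp add: sums_iff)
  qed
qed

section \<open>Mixing of Bernoulli measures along the powers of \<open>t\<close>\<close>

context Z_height
begin

context
  fixes A :: "'c set" and p :: "'c measure"
  assumes finite_A: "finite A" and prob_p: "prob_space p" and sets_p: "sets p = Pow A"
begin

interpretation p: prob_space p by (fact prob_p)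

interpretation product_prob_space "\<lambda>_. p" "carrier G"
  by unfold_locales

abbreviation \<beta> where "\<beta> \<equiv> PiM (carrier G) (\<lambda>_. p)"

lemma space_\<beta>: "space \<beta> = topspace (config_top G A)"
  using sets_eq_imp_space_eq[of p "count_space A"] sets_p
  by (simp add: space_PiM topspace_config_top)

lemma config_prob_\<beta>: "config_prob G A \<beta>"
  unfolding config_prob_def
  using sets_PiM_eq_config_borel[OF countable_carrier finite_A sets_p] P.prob_space_axioms by simp

lemma measurable_shift: "g \<in> carrier G \<Longrightarrow> shift G g \<in> measurable \<beta> \<beta>"
  unfolding shift_def by (intro measurable_restrict measurable_component_singleton) auto

text \<open>The shift permutes the coordinates of a product of identical factors.\<close>

lemma distr_shift:
  assumes g: "g \<in> carrier G"
  shows "distr \<beta> \<beta> (shift G g) = \<beta>"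
  unfolding shift_def
  using distr_PiM_reindex[of "carrier G" "\<lambda>_. p" "(\<otimes>) (inv g)" "carrier G"] g prob_p
  by (auto simp: inj_on_def)

lemma emeasure_vimage_shift:
  assumes "g \<in> carrier G" "E \<in> sets \<beta>"
  shows "emeasure \<beta> (shift G g -` E \<inter> space \<beta>) = emeasure \<beta> E"
  using emeasure_distr[OF measurable_shift[OF assms(1)] assms(2)] distr_shift[OF assms(1)] by simp

lemma shift_image_\<beta>:
  assumes "g \<in> carrier G" "E \<in> sets \<beta>"
  shows "shift G (inv g) ` E = shift G g -` E \<inter> space \<beta>"
  using shift_image_vimage[of E A g] sets.sets_into_space[OF assms(2)] assms(1)
  by (simp add: space_\<beta>)

lemma shift_invariant_\<beta>: "shift_invariant G A \<beta>"
  unfolding shift_invariant_def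
  using config_prob_\<beta> shift_image_\<beta> emeasure_vimage_shift by simp

abbreviation \<tau> where "\<tau> n E \<equiv> shift G (t [^] int n) -` E \<inter> space \<beta>"

lemma \<tau>_sets: "E \<in> sets \<beta> \<Longrightarrow> \<tau> n E \<in> sets \<beta>"
  using measurable_shift[of "t [^] int n"] by (intro measurable_sets) auto

lemma measure_\<tau>: "E \<in> sets \<beta> \<Longrightarrow> measure \<beta> (\<tau> n E) = measure \<beta> E"
  using emeasure_vimage_shift[of "t [^] int n" E] by (simp add: measure_def)

text \<open>Far translates of a finite set of coordinates are disjoint from any given finite set.\<close>

lemma mixing_cylinders:
  assumes E: "E \<in> prod_algebra (carrier G) (\<lambda>_. p)" and D: "D \<in> prod_algebra (carrier G) (\<lambda>_. p)"
  shows "(\<lambda>n. measure \<beta> (E \<inter> \<tau> n D)) \<longlonglongrightarrow> measure \<beta> E * measure \<beta> D"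
proof -
  obtain J X where J: "E = prod_emb (carrier G) (\<lambda>_. p) J (\<Pi>\<^sub>E j\<in>J. X j)" "finite J" "J \<subseteq> carrier G"
    "\<And>j. j \<in> J \<Longrightarrow> X j \<in> sets p"
    using E by (elim prod_algebraE) auto
  obtain K Y where K: "D = prod_emb (carrier G) (\<lambda>_. p) K (\<Pi>\<^sub>E j\<in>K. Y j)" "finite K" "K \<subseteq> carrier G"
    "\<And>j. j \<in> K \<Longrightarrow> Y j \<in> sets p"
    using D by (elim prod_algebraE) auto
  have emb: "prod_emb (carrier G) (\<lambda>_. p) J (\<Pi>\<^sub>E j\<in>J. X j) = {x \<in> space \<beta>. \<forall>j\<in>J. x j \<in> X j}"
    if "J \<subseteq> carrier G" for J X
    using that by (auto simp: prod_emb_def space_PiM PiE_iff extensional_def)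
  obtain N where N: "J \<union> K \<subseteq> slab (- N) N"
    using J K finite_subset_slab[of "J \<union> K"] by (metis finite_UnI le_sup_iff)
  \<comment> \<open>Both windows lie at heights between \<open>- N\<close> and \<open>N\<close>;
    lowering \<open>K\<close> by more than \<open>2 * N\<close> puts it below \<open>J\<close>, and
    independence makes the product exact.\<close>
  have "measure \<beta> (E \<inter> \<tau> n D) = measure \<beta> E * measure \<beta> D" if n: "int n > 2 * N" for n
  proof -
    define g where "g = inv (t [^] int n)"
    have g: "g \<in> carrier G" by (simp add: g_def)
    have gK: "(\<otimes>) g ` K \<subseteq> carrier G" using K g by auto
    have disj: "J \<inter> (\<otimes>) g ` K = {}"
    proof -
      have "ht (g \<otimes> k) < - N" if "k \<in> K" for k
      proof -
        have "g = t [^] (- int n)" by (simp add: g_def int_pow_neg)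
        then show ?thesis
          using that N n K ht_t_pow_mult[of k "- int n"] by (fastforce simp: slab_def)
      qed
      then show ?thesis using N by (fastforce simp: slab_def)
    qed
    \<comment> \<open>Merges both families of constraints into one over the union of the windows;
      disjointness prevents a conflict.\<close>
    define Z where "Z i = (if i \<in> J then X i else Y (inv g \<otimes> i))" for i
    have cancel: "inv g \<otimes> (g \<otimes> k) = k" if "k \<in> K" for k
      using that K g by (auto simp flip: m_assoc)
    have inj: "inj_on ((\<otimes>) g) K" using cancel by (metis inj_onI)
    have Z1: "Z i = X i" if "i \<in> J" for i using that by (simp add: Z_def)
    have Z2: "Z (g \<otimes> k) = Y k" if "k \<in> K" for k
      using that disj cancel by (auto simp: Z_def)
    have Z_sets: "Z i \<in> sets p" if "i \<in> J \<union> (\<otimes>) g ` K" for i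
      using that J(4) K(4) Z1 Z2 by auto
    have shift_at: "shift G (t [^] int n) x k = x (g \<otimes> k)" if "k \<in> K" for x :: "'a \<Rightarrow> 'c" and k
      using that K by (auto simp: shift_def g_def)
    have "(\<forall>i\<in>J \<union> (\<otimes>) g ` K. x i \<in> Z i) \<longleftrightarrow> (\<forall>j\<in>J. x j \<in> X j) \<and> (\<forall>k\<in>K. x (g \<otimes> k) \<in> Y k)" for x
      by (simp add: ball_Un Z1 Z2)
    then have "E \<inter> \<tau> n D = {x \<in> space \<beta>. \<forall>i\<in>J \<union> (\<otimes>) g ` K. x i \<in> Z i}"
      using measurable_space[OF measurable_shift[of "t [^] int n"]]
      unfolding J(1) K(1) emb[OF J(3)] emb[OF K(3)] by (auto simp: shift_at)
    then have "emeasure \<beta> (E \<inter> \<tau> n D) = (\<Prod>i\<in>J \<union> (\<otimes>) g ` K. emeasure p (Z i))"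
      using emeasure_PiM_Collect[of "J \<union> (\<otimes>) g ` K" Z] J K gK Z_sets by simp
    also have "\<dots> = (\<Prod>i\<in>J. emeasure p (Z i)) * (\<Prod>i\<in>(\<otimes>) g ` K. emeasure p (Z i))"
      using J(2) K(2) disj by (intro prod.union_disjoint) auto
    also have "(\<Prod>i\<in>(\<otimes>) g ` K. emeasure p (Z i)) = (\<Prod>k\<in>K. emeasure p (Y k))"
      using inj by (simp add: prod.reindex Z2)
    also have "(\<Prod>i\<in>J. emeasure p (Z i)) = (\<Prod>i\<in>J. emeasure p (X i))"
      by (simp add: Z1)
    also have "\<dots> * (\<Prod>k\<in>K. emeasure p (Y k)) = emeasure \<beta> E * emeasure \<beta> D"
      unfolding J(1) K(1) emb[OF J(3)] emb[OF K(3)] using J K by (simp add: emeasure_PiM_Collect)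
    finally show ?thesis by (simp add: measure_def enn2real_mult)
  qed
  then have "\<forall>\<^sub>F n in sequentially. measure \<beta> (E \<inter> \<tau> n D) = measure \<beta> E * measure \<beta> D"
    by (intro eventually_sequentiallyI[of "nat (2 * N) + 1"]) auto
  then show ?thesis by (rule tendsto_eventually)
qed

lemma prod_algebra_generates:
  "Int_stable (prod_algebra (carrier G) (\<lambda>_. p))"
  "prod_algebra (carrier G) (\<lambda>_. p) \<subseteq> Pow (space \<beta>)"
  "sets \<beta> = sigma_sets (space \<beta>) (prod_algebra (carrier G) (\<lambda>_. p))"
  using prod_algebra_sets_into_space[of "carrier G" "\<lambda>_. p"]
  by (simp_all add: Int_stable_prod_algebra sets_PiM space_PiM)

text \<open>The passage from cylinders to events is made one argument at a time, the translated one
  first. Domination by \<open>measure \<beta> B\<close> rests on invariance under the shift.\<close>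

lemma mixing_cylinder_event:
  assumes E: "E \<in> prod_algebra (carrier G) (\<lambda>_. p)" and D: "D \<in> sets \<beta>"
  shows "(\<lambda>n. measure \<beta> (E \<inter> \<tau> n D)) \<longlonglongrightarrow> measure \<beta> E * measure \<beta> D"
proof (rule tendsto_sigma_sets_dominated[OF P.finite_measure_axioms prod_algebra_generates,
      where f = "\<lambda>n B. measure \<beta> (E \<inter> \<tau> n B)" and l = "\<lambda>B. measure \<beta> E * measure \<beta> B"])
  have E_sets: "E \<in> sets \<beta>" using E by (auto simp: prod_algebra_generates(3))
  show "\<bar>measure \<beta> (E \<inter> \<tau> n B)\<bar> \<le> measure \<beta> B" if "B \<in> sets \<beta>" for n B
    using P.finite_measure_mono[OF Int_lower2 \<tau>_sets[OF that], of E n] measure_\<tau>[OF that, of n]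
    by (simp only: abs_of_nonneg measure_nonneg)
  show "(\<lambda>i. measure \<beta> (E \<inter> \<tau> n (B i))) sums measure \<beta> (E \<inter> \<tau> n (\<Union>i. B i))"
    if "range B \<subseteq> sets \<beta>" "disjoint_family B" for n B
  proof -
    have "range (\<lambda>i. E \<inter> \<tau> n (B i)) \<subseteq> sets \<beta>" using that(1) E_sets \<tau>_sets by blast
    moreover have "disjoint_family (\<lambda>i. E \<inter> \<tau> n (B i))"
      using that(2) by (fastforce simp: disjoint_family_on_def)
    moreover have "E \<inter> \<tau> n (\<Union>i. B i) = (\<Union>i. E \<inter> \<tau> n (B i))" by auto
    ultimately show ?thesis using P.finite_measure_UNION by metis
  qed
  show "(\<lambda>i. measure \<beta> E * measure \<beta> (B i)) sums (measure \<beta> E * measure \<beta> (\<Union>i. B i))"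
    if "range B \<subseteq> sets \<beta>" "disjoint_family B" for B
    using that by (intro sums_mult P.finite_measure_UNION)
  show "measure \<beta> (E \<inter> \<tau> n (space \<beta> - B)) = measure \<beta> (E \<inter> \<tau> n (space \<beta>)) - measure \<beta> (E \<inter> \<tau> n B)"
    if B: "B \<in> sets \<beta>" for n B
  proof -
    have "E \<inter> \<tau> n (space \<beta> - B) = E \<inter> \<tau> n (space \<beta>) - E \<inter> \<tau> n B" by auto
    moreover have "E \<inter> \<tau> n B \<subseteq> E \<inter> \<tau> n (space \<beta>)" using sets.sets_into_space[OF B] by blast
    ultimately show ?thesis
      using E_sets \<tau>_sets[OF B, of n] \<tau>_sets[OF sets.top, of n] by (simp only: P.finite_measure_Diff sets.Int)
  qed
  show "measure \<beta> E * measure \<beta> (space \<beta> - B) = measure \<beta> E * measure \<beta> (space \<beta>) - measure \<beta> E * measure \<beta> B"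
    if "B \<in> sets \<beta>" for B
    using that by (simp add: P.prob_compl P.prob_space algebra_simps)
  have "E \<inter> \<tau> n (space \<beta>) = E" for n
    using measurable_space[OF measurable_shift[of "t [^] int n"]] sets.sets_into_space[OF E_sets] by auto
  then show "(\<lambda>n. measure \<beta> (E \<inter> \<tau> n (space \<beta>))) \<longlonglongrightarrow> measure \<beta> E * measure \<beta> (space \<beta>)"
    by (simp add: P.prob_space)
  show "(\<lambda>n. measure \<beta> (E \<inter> \<tau> n B)) \<longlonglongrightarrow> measure \<beta> E * measure \<beta> B"
    if "B \<in> prod_algebra (carrier G) (\<lambda>_. p)" for B
    using E that by (rule mixing_cylinders)
qed (fact D)

text \<open>Now the other argument varies, and domination is plain monotonicity.\<close>

lemma mixing:
  assumes E: "E \<in> sets \<beta>" and D: "D \<in> sets \<beta>"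
  shows "(\<lambda>n. measure \<beta> (E \<inter> \<tau> n D)) \<longlonglongrightarrow> measure \<beta> E * measure \<beta> D"
proof (rule tendsto_sigma_sets_dominated[OF P.finite_measure_axioms prod_algebra_generates,
      where f = "\<lambda>n B. measure \<beta> (B \<inter> \<tau> n D)" and l = "\<lambda>B. measure \<beta> B * measure \<beta> D"])
  note D_sets = \<tau>_sets[OF D]
  show "\<bar>measure \<beta> (B \<inter> \<tau> n D)\<bar> \<le> measure \<beta> B" if "B \<in> sets \<beta>" for n B
    using P.finite_measure_mono[OF Int_lower1 that] by simp
  show "(\<lambda>i. measure \<beta> (B i \<inter> \<tau> n D)) sums measure \<beta> ((\<Union>i. B i) \<inter> \<tau> n D)"
    if "range B \<subseteq> sets \<beta>" "disjoint_family B" for n B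
  proof -
    have "range (\<lambda>i. B i \<inter> \<tau> n D) \<subseteq> sets \<beta>" using that(1) D_sets by blast
    moreover have "disjoint_family (\<lambda>i. B i \<inter> \<tau> n D)"
      using that(2) by (fastforce simp: disjoint_family_on_def)
    moreover have "(\<Union>i. B i) \<inter> \<tau> n D = (\<Union>i. B i \<inter> \<tau> n D)" by auto
    ultimately show ?thesis using P.finite_measure_UNION by metis
  qed
  show "(\<lambda>i. measure \<beta> (B i) * measure \<beta> D) sums (measure \<beta> (\<Union>i. B i) * measure \<beta> D)"
    if "range B \<subseteq> sets \<beta>" "disjoint_family B" for B
    using that by (intro sums_mult2 P.finite_measure_UNION)
  show "measure \<beta> ((space \<beta> - B) \<inter> \<tau> n D) = measure \<beta> (space \<beta> \<inter> \<tau> n D) - measure \<beta> (B \<inter> \<tau> n D)"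
    if B: "B \<in> sets \<beta>" for n B
  proof -
    have "(space \<beta> - B) \<inter> \<tau> n D = space \<beta> \<inter> \<tau> n D - B \<inter> \<tau> n D" by auto
    moreover have "B \<inter> \<tau> n D \<subseteq> space \<beta> \<inter> \<tau> n D" using sets.sets_into_space[OF B] by blast
    ultimately show ?thesis
      using D_sets[of n] B by (simp only: P.finite_measure_Diff sets.Int sets.top)
  qed
  show "measure \<beta> (space \<beta> - B) * measure \<beta> D = measure \<beta> (space \<beta>) * measure \<beta> D - measure \<beta> B * measure \<beta> D"
    if "B \<in> sets \<beta>" for B
    using that by (simp add: P.prob_compl P.prob_space algebra_simps)
  have "space \<beta> \<inter> \<tau> n D = \<tau> n D" for n by auto
  then show "(\<lambda>n. measure \<beta> (space \<beta> \<inter> \<tau> n D)) \<longlonglongrightarrow> measure \<beta> (space \<beta>) * measure \<beta> D"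
    using measure_\<tau>[OF D] by (simp add: P.prob_space)
  show "(\<lambda>n. measure \<beta> (B \<inter> \<tau> n D)) \<longlonglongrightarrow> measure \<beta> B * measure \<beta> D"
    if "B \<in> prod_algebra (carrier G) (\<lambda>_. p)" for B
    using that D by (rule mixing_cylinder_event)
qed (fact E)

lemma shift_ergodic_\<beta>: "shift_ergodic G A \<beta>"
  unfolding shift_ergodic_def
proof (intro conjI ballI impI shift_invariant_\<beta>)
  fix E assume E: "E \<in> sets \<beta>" and inv: "\<forall>g\<in>carrier G. shift G (inv g) ` E = E"
  have "\<tau> n E = E" for n
    using inv shift_image_\<beta>[OF _ E, of "t [^] int n"] by simp
  \<comment> \<open>For an invariant event the mixing sequence is constant, so its measure equals
    its own square.\<close>
  then have "(\<lambda>n::nat. measure \<beta> E) \<longlonglongrightarrow> measure \<beta> E * measure \<beta> E"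
    using mixing[OF E E] by simp
  then have "measure \<beta> E = measure \<beta> E * measure \<beta> E"
    by (simp add: LIMSEQ_const_iff)
  then show "emeasure \<beta> E \<in> {0, 1}"
    by (auto simp: P.emeasure_eq_measure)
qed

end

end

section \<open>The dichotomy for virtually Z groups\<close>

lemma (in Z_height) sensitive_or_equicontinuous:
  assumes "finite A" "shift_ergodic G A \<mu>" "cellular_automaton G A \<phi>"
  shows "mu_sensitive G A \<mu> \<phi> \<or> mu_equicontinuous G A \<mu> \<phi>"
proof -
  interpret ergodic_Z_cellular G ht t A \<phi> \<mu>
    by unfold_locales (use assms in \<open>auto simp: shift_ergodic_def shift_invariant_def\<close>)
  show ?thesis by (rule sensitive_or_equicontinuous)
qed

theorem theorem4p3:
  fixes G :: "('g, 'm) monoid_scheme" and A :: "'a set"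
    and \<mu> :: "('g \<Rightarrow> 'a) measure" and \<phi> :: "('g \<Rightarrow> 'a) \<Rightarrow> 'g \<Rightarrow> 'a"
  assumes "group G" and "virtually_Z G"
  shows "(finite A \<longrightarrow> shift_ergodic G A \<mu> \<longrightarrow> cellular_automaton G A \<phi> \<longrightarrow>
            mu_sensitive G A \<mu> \<phi> \<or> mu_equicontinuous G A \<mu> \<phi>)
       \<and> gilman_dichotomy TYPE('b) G"
proof -
  obtain ht t where Z: "Z_height G ht t"
    using virtually_Z_imp_Z_height[OF assms] .
  have "gilman_dichotomy TYPE('b) G"
    unfolding gilman_dichotomy_def bernoulli_measure_def
  proof (intro allI impI, elim exE conjE)
    fix A :: "'b set" and \<mu> \<phi> p
    assume A: "finite A" and \<phi>: "cellular_automaton G A \<phi>"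
      and p: "prob_space p" "sets p = Pow A" and \<mu>: "\<mu> = PiM (carrier G) (\<lambda>_. p)"
    \<comment> \<open>Ergodicity reduces the Bernoulli case to the ergodic one, here with an
      alphabet in the separate type \<open>'b\<close>.\<close>
    have "shift_ergodic G A \<mu>"
      unfolding \<mu> using Z A p by (rule Z_height.shift_ergodic_\<beta>)
    with Z A show "mu_sensitive G A \<mu> \<phi> \<or> mu_equicontinuous G A \<mu> \<phi>"
      using \<phi> by (rule Z_height.sensitive_or_equicontinuous)
  qed
  then show ?thesis
    by (intro conjI impI Z_height.sensitive_or_equicontinuous[OF Z])
qed

end
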